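(* Let $N\ge 2$ and $k\ge 1$ be integers with $k\le N^2/2$, and consider the $N\times N$ torus with unit link capacities. (a) Suppose $2k$ is a perfect square, and put $r=\sqrt{k/2}\in\mathbb{N}$. Then there is a traffic matrix $d\in\mathcal{D}_k$ such that every symmetric routing policy $g\in\mathcal{R}_{sym}$ satisfies $\mathrm{MaxLoad}(g,d)\ge \frac{\sqrt{2k}}{4}$. When $N$ is even, $d$ can be taken to be the Split-Diamond traffic matrix $d^{SD(r)}$, which belongs to $\mathcal{D}_k$. (b) Suppose $2k$ is not a perfect square, and let $k'$ be the largest integer such that $k'\le k$ and $2k'$ is a perfect square. Then there is a traffic matrix $d\in\mathcal{D}_k$ such that every $g\in\mathcal{R}_{sym}$ satisfies $\mathrm{MaxLoad}(g,d)\ge \frac{\sqrt{2k'}}{4}$.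
   Context: Torus. $V=\{0,\dots,N-1\}^2$, with addition and subtraction of nodes coordinatewise modulo $N$; nodes are written $i=(i_x,i_y)$ and $0$ denotes the node $(0,0)$. Let $e_1=(1,0)$, $e_2=(0,1)$, $A=\{e_1,e_2,-e_1,-e_2\}$. The directed links are $E=\{(i,i+e): i\in V, e\in A\}$, each of capacity $1$. Traffic. A traffic matrix $d$ assigns a number $d_{s,s+t}\ge 0$ to each source $s\in V$ and displacement $t\in V\setminus\{0\}$ (the demand from $s$ to $s+t$). $\mathcal{D}_k$ is the set of traffic matrices with $\sum_{t\ne 0} d_{s,s+t}\le 1$ for all $s\in V$, $\sum_{t\neq 0} d_{s-t,s}\le 1$ for all $s\in V$, and $\sum_{s,t} d_{s,s+t}\le k$. Symmetric routing policies. Let $R_{xy}(i)=(i_y,i_x)$ and $R_0(i)=-i$. $\mathcal{R}_{sym}$ is the set of families $g=(g^t_{i,i+e})$, $t\in V\setminus\{0\}$, $i\in V$, $e\in A$, such that (1) for all $t$ and $i$, $\sum_{e\in A} g^t_{i,i+e}-\sum_{e\in A} g^t_{i-e,i}$ equals $1$ if $i=0$, $-1$ if $i=t$, and $0$ otherwise; (2) $g^t_{i,i+e}=g^{R_{xy}(t)}_{R_{xy}(i),R_{xy}(i+e)}=g^{R_0(t)}_{R_0(i),R_0(i+e)}$ for all $i,e,t$; (3) $0\le g^t_{i,i+e}\le 1$ for all $i,e,t$. Here $g^t_{i,i+e}$ is the fraction of the traffic from $0$ to $t$ carried by link $(i,i+e)$; traffic from $s$ to $s+t$ is routed by translation, i.e.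 the fraction of it on link $(i,i+e)$ is $f^{s,s+t}_{i,i+e}=g^t_{i-s,i-s+e}$. Load. $\mathrm{MaxLoad}(g,d)=\max_{(i,i+e)\in E}\sum_{s\in V,\,t\in V\setminus\{0\}} d_{s,s+t}\, g^t_{i-s,i-s+e}$. Split-Diamond traffic ($N$ even, $r\in\mathbb{N}$). Let $\Delta(u,v)=\min\{(u_x-v_x)\bmod N,(v_x-u_x)\bmod N\}+\min\{(u_y-v_y)\bmod N,(v_y-u_y)\bmod N\}$ and $t^*=(N/2,N/2)$. Let $\mathcal{E}_1(r)=\{j\in V:\Delta(j,0)<r,\ j_y\le N/2-1\}$ and $\mathcal{E}_2(r)=\{j\in V:\Delta(j,t^* )\le r,\ j_y\le N/2-1\}$. Then $d^{SD(r)}_{s,s+t}=1$ if $s\in\mathcal{E}_1(r)\cup\mathcal{E}_2(r)$ and $t=t^*$, and $d^{SD(r)}_{s,s+t}=0$ otherwise. *)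

theory Defs
  imports Complex_Main "HOL-Computational_Algebra.Nth_Powers"
begin

type_synonym node = "int \<times> int"

definition nodes :: "nat \<Rightarrow> node set" where
  "nodes N = {0..<int N} \<times> {0..<int N}"

definition nadd :: "nat \<Rightarrow> node \<Rightarrow> node \<Rightarrow> node" where
  "nadd N u v = ((fst u + fst v) mod int N, (snd u + snd v) mod int N)"

definition nsub :: "nat \<Rightarrow> node \<Rightarrow> node \<Rightarrow> node" where
  "nsub N u v = ((fst u - fst v) mod int N, (snd u - snd v) mod int N)"

definition nneg :: "nat \<Rightarrow> node \<Rightarrow> node" where
  "nneg N u = nsub N (0, 0) u"

(* The directions are nodes of the torus, so for N = 2 (where e = -e) this set has two
   elements, and (i, i + e) and (i, i - e) are one and the same link. *)
definition dirs :: "nat \<Rightarrow> node set" where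
  "dirs N = {(1, 0), (0, 1), nneg N (1, 0), nneg N (0, 1)}"

definition displacements :: "nat \<Rightarrow> node set" where
  "displacements N = nodes N - {(0, 0)}"

(* A traffic matrix d is indexed by source and destination.  Only the entries d s (s + t) with
   s a node and t a displacement are meaningful; all others are irrelevant. *)
definition traffic :: "nat \<Rightarrow> nat \<Rightarrow> (node \<Rightarrow> node \<Rightarrow> real) set" where
  "traffic N k = {d.
     (\<forall>s\<in>nodes N. \<forall>t\<in>displacements N. d s (nadd N s t) \<ge> 0) \<and>
     (\<forall>s\<in>nodes N. (\<Sum>t\<in>displacements N. d s (nadd N s t)) \<le> 1) \<and>
     (\<forall>s\<in>nodes N. (\<Sum>t\<in>displacements N. d (nsub N s t) s) \<le> 1) \<and>
     (\<Sum>s\<in>nodes N. \<Sum>t\<in>displacements N. d s (nadd N s t)) \<le> real k}"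

(* g t i j is the fraction of the traffic from (0, 0) to t carried by the link (i, j).
   Again, only displacements t and links (i, j) of the torus matter.
   The reflection R_xy is the library function prod.swap, and R_0 is nneg N. *)
definition sym_routings :: "nat \<Rightarrow> (node \<Rightarrow> node \<Rightarrow> node \<Rightarrow> real) set" where
  "sym_routings N = {g.
     (\<forall>t\<in>displacements N. \<forall>i\<in>nodes N.
        (\<Sum>e\<in>dirs N. g t i (nadd N i e)) - (\<Sum>e\<in>dirs N. g t (nsub N i e) i) =
          (if i = (0, 0) then 1 else if i = t then - 1 else 0)) \<and>
     (\<forall>t\<in>displacements N. \<forall>i\<in>nodes N. \<forall>e\<in>dirs N.
        g t i (nadd N i e) = g (prod.swap t) (prod.swap i) (prod.swap (nadd N i e)) \<and>
        g t i (nadd N i e) = g (nneg N t) (nneg N i) (nneg N (nadd N i e))) \<and>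
     (\<forall>t\<in>displacements N. \<forall>i\<in>nodes N. \<forall>e\<in>dirs N.
        0 \<le> g t i (nadd N i e) \<and> g t i (nadd N i e) \<le> 1)}"

definition link_load ::
    "nat \<Rightarrow> (node \<Rightarrow> node \<Rightarrow> node \<Rightarrow> real) \<Rightarrow> (node \<Rightarrow> node \<Rightarrow> real) \<Rightarrow> node \<Rightarrow> node \<Rightarrow> real" where
  "link_load N g d i e =
     (\<Sum>s\<in>nodes N. \<Sum>t\<in>displacements N.
        d s (nadd N s t) * g t (nsub N i s) (nadd N (nsub N i s) e))"

definition max_load ::
    "nat \<Rightarrow> (node \<Rightarrow> node \<Rightarrow> node \<Rightarrow> real) \<Rightarrow> (node \<Rightarrow> node \<Rightarrow> real) \<Rightarrow> real" where
  "max_load N g d = Max {link_load N g d i e | i e. i \<in> nodes N \<and> e \<in> dirs N}"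

definition torus_dist :: "nat \<Rightarrow> node \<Rightarrow> node \<Rightarrow> int" where
  "torus_dist N u v =
     min ((fst u - fst v) mod int N) ((fst v - fst u) mod int N) +
     min ((snd u - snd v) mod int N) ((snd v - snd u) mod int N)"

(* The notions below are intended for even N only. *)

definition antipode :: "nat \<Rightarrow> node" where
  "antipode N = (int N div 2, int N div 2)"

definition half_diamond1 :: "nat \<Rightarrow> nat \<Rightarrow> node set" where
  "half_diamond1 N r =
     {j \<in> nodes N. torus_dist N j (0, 0) < int r \<and> snd j \<le> int N div 2 - 1}"

definition half_diamond2 :: "nat \<Rightarrow> nat \<Rightarrow> node set" where
  "half_diamond2 N r =
     {j \<in> nodes N. torus_dist N j (antipode N) \<le> int r \<and> snd j \<le> int N div 2 - 1}"

definition split_diamond :: "nat \<Rightarrow> nat \<Rightarrow> node \<Rightarrow> node \<Rightarrow> real" where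
  "split_diamond N r s u =
     (if s \<in> half_diamond1 N r \<union> half_diamond2 N r \<and> u = nadd N s (antipode N) then 1 else 0)"

end

theory Submission
  imports Defs "HOL-Library.Product_Plus"
begin

text \<open>
  The whole bound comes from the single link from (0, 0) to (0, -1).  Let h = N div 2 and
  t = (h, h).  Averaged over t and -t, a symmetric routing sends the same amount out of an l1-ball
  in each of the four directions; hence the downward links leaving the ball, which start on the
  lower half of its sphere, carry at least a quarter of the flow.  Placing sources at the negatives of the lower
  half-diamond translates all these links onto the single link,
  which yields load r / 4 over r spheres.  Placing sinks just below makes the traffic arriving at its
  destination contribute r / 4 in the same way: reversing all flows turns sinks into sources.
  For odd N, where t and -t differ, each source splits its demand equally between t and -t; for
  even N they coincide and the traffic is the Split-Diamond matrix.
\<close>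

subsection \<open>Arithmetic on the torus\<close>

text \<open>Nodes are handled through integer vectors, where the group laws apply directly; every
  torus operation becomes a single outermost \<open>wrap\<close>, since inner ones are
  absorbed.\<close>

definition wrap :: "nat \<Rightarrow> node \<Rightarrow> node" where
  "wrap N v = (fst v mod int N, snd v mod int N)"

lemma nadd_eq_wrap: "nadd N u v = wrap N (u + v)"
  and nsub_eq_wrap: "nsub N u v = wrap N (u - v)"
  and nneg_eq_wrap: "nneg N u = wrap N (- u)"
  by (simp_all add: nadd_def nsub_def nneg_def wrap_def)

lemmas node_ops_eq_wrap = nadd_eq_wrap nsub_eq_wrap nneg_eq_wrap

lemma wrap_wrap [simp]:
  "wrap N (wrap N u) = wrap N u"
  "wrap N (wrap N u + v) = wrap N (u + v)"
  "wrap N (u + wrap N v) = wrap N (u + v)"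
  "wrap N (wrap N u - v) = wrap N (u - v)"
  "wrap N (u - wrap N v) = wrap N (u - v)"
  "wrap N (- wrap N u) = wrap N (- u)"
  by (simp_all add: wrap_def mod_simps)

lemma swap_wrap: "prod.swap (wrap N v) = wrap N (prod.swap v)"
  by (simp add: wrap_def)

lemma swap_plus: "prod.swap (u + v) = prod.swap u + prod.swap (v :: node)"
  and swap_minus: "prod.swap (u - v) = prod.swap u - prod.swap (v :: node)"
  and swap_uminus: "prod.swap (- v) = - prod.swap (v :: node)"
  by (simp_all add: prod_eq_iff)

lemma wrap_in_nodes: "N > 0 \<Longrightarrow> wrap N v \<in> nodes N"
  by (simp add: wrap_def nodes_def)

lemma wrap_node: "v \<in> nodes N \<Longrightarrow> wrap N v = v"
  by (auto simp: wrap_def nodes_def)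

lemma finite_nodes: "finite (nodes N)"
  by (simp add: nodes_def)

lemma wrap_eq_iff:
  "wrap N u = wrap N v \<longleftrightarrow> int N dvd fst u - fst v \<and> int N dvd snd u - snd v"
  by (simp add: wrap_def mod_eq_dvd_iff)

lemma wrap_add_cancel: "wrap N (u + w) = wrap N (v + w) \<longleftrightarrow> wrap N u = wrap N v"
  by (simp add: wrap_eq_iff)

lemma wrap_eq_iff_diff: "wrap N u = wrap N v \<longleftrightarrow> wrap N (u - v) = (0, 0)"
  by (simp add: wrap_eq_iff) (simp add: wrap_def dvd_eq_mod_eq_0)

lemma wrap_uminus_eq_zero: "wrap N (- v) = (0, 0) \<longleftrightarrow> wrap N v = (0, 0)"
  by (auto simp: wrap_def mod_eq_0_iff_dvd)

text \<open>Integer lifts of the directions: four distinct vectors even for N = 2, where their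
  images under \<open>wrap N\<close> coincide in pairs.\<close>

definition units :: "node set" where
  "units = {(1, 0), (0, 1), (-1, 0), (0, -1)}"

lemma dirs_eq_wrap_units: "N \<ge> 2 \<Longrightarrow> dirs N = wrap N ` units"
  by (auto simp: dirs_def units_def node_ops_eq_wrap wrap_def)

lemma finite_dirs: "finite (dirs N)"
  by (simp add: dirs_def)

lemma displacements_in_nodes: "t \<in> displacements N \<Longrightarrow> t \<in> nodes N"
  by (simp add: displacements_def)

lemma finite_displacements: "finite (displacements N)"
  by (simp add: displacements_def finite_nodes)

lemma nneg_displacements:
  assumes "N > 0" "t \<in> displacements N"
  shows "nneg N t \<in> displacements N"
  using assms wrap_in_nodes[of N "- t"] wrap_uminus_eq_zero[of N t] wrap_node[of t N]
  by (auto simp: displacements_def node_ops_eq_wrap)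

subsection \<open>Symmetric routings\<close>

lemma sym_routings_swap:
  assumes "g \<in> sym_routings N" "N \<ge> 2" "t \<in> displacements N" "a \<in> units"
  shows "g t (wrap N v) (wrap N (v + a)) =
         g (prod.swap t) (wrap N (prod.swap v)) (wrap N (prod.swap (v + a)))"
proof -
  have "wrap N v \<in> nodes N" "wrap N a \<in> dirs N"
    using assms by (auto simp: wrap_in_nodes dirs_eq_wrap_units)
  then have "g t (wrap N v) (nadd N (wrap N v) (wrap N a)) =
      g (prod.swap t) (prod.swap (wrap N v)) (prod.swap (nadd N (wrap N v) (wrap N a)))"
    using assms(1,3) unfolding sym_routings_def by blast
  then show ?thesis
    by (simp add: node_ops_eq_wrap swap_wrap)
qed

lemma sym_routings_neg:
  assumes "g \<in> sym_routings N" "N \<ge> 2" "t \<in> displacements N" "a \<in> units"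
  shows "g t (wrap N v) (wrap N (v + a)) =
         g (nneg N t) (wrap N (- v)) (wrap N (- (v + a)))"
proof -
  have "wrap N v \<in> nodes N" "wrap N a \<in> dirs N"
    using assms by (auto simp: wrap_in_nodes dirs_eq_wrap_units)
  then have "g t (wrap N v) (nadd N (wrap N v) (wrap N a)) =
      g (nneg N t) (nneg N (wrap N v)) (nneg N (nadd N (wrap N v) (wrap N a)))"
    using assms(1,3) unfolding sym_routings_def by blast
  then show ?thesis
    by (simp add: node_ops_eq_wrap)
qed

lemma sym_routings_bounds:
  assumes "g \<in> sym_routings N" "t \<in> displacements N" "i \<in> nodes N" "e \<in> dirs N"
  shows "g t i (nadd N i e) \<ge> 0" and "g t i (nadd N i e) \<le> 1"
  using assms unfolding sym_routings_def by blast+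

lemma sym_routings_flow:
  assumes "g \<in> sym_routings N" "t \<in> displacements N" "i \<in> nodes N"
  shows "(\<Sum>e\<in>dirs N. g t i (nadd N i e)) - (\<Sum>e\<in>dirs N. g t (nsub N i e) i) =
          (if i = (0, 0) then 1 else if i = t then - 1 else 0)"
  using assms unfolding sym_routings_def by blast

text \<open>The reflection \<open>i \<mapsto> t - i\<close> maps a flow from 0 to t to one from t to 0; reversing its
  links gives a flow from 0 to t again.\<close>

definition reverse_routing ::
    "nat \<Rightarrow> (node \<Rightarrow> node \<Rightarrow> node \<Rightarrow> real) \<Rightarrow> node \<Rightarrow> node \<Rightarrow> node \<Rightarrow> real" where
  "reverse_routing N g t i j = g t (nsub N t j) (nsub N t i)"

text \<open>The outflow of the reversed routing at \<open>i\<close> is the inflow of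
  \<open>g\<close> at \<open>t - i\<close> and conversely, and this reflection is compatible with
  swapping or negating \<open>t\<close> and \<open>i\<close> together.\<close>

lemma reverse_routing_in_sym_routings:
  assumes g: "g \<in> sym_routings N" and N: "N \<ge> 2"
  shows "reverse_routing N g \<in> sym_routings N"
proof -
  have flow: "(\<Sum>e\<in>dirs N. reverse_routing N g t i (nadd N i e)) -
        (\<Sum>e\<in>dirs N. reverse_routing N g t (nsub N i e) i) =
        (if i = (0, 0) then 1 else if i = t then - 1 else 0)"
    if t: "t \<in> displacements N" and i: "i \<in> nodes N" for t i
  proof -
    let ?j = "nsub N t i"
    have j: "?j \<in> nodes N"
      using N by (simp add: node_ops_eq_wrap wrap_in_nodes)
    have tn: "t \<in> nodes N" "t \<noteq> (0, 0)"
      using t by (auto simp: displacements_def)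
    \<comment> \<open>The reflection exchanges 0 and \<open>t\<close>, so the signs in the
      conservation law flip just as inflow and outflow do.\<close>
    have j0: "?j = (0, 0) \<longleftrightarrow> i = t"
      using wrap_eq_iff_diff[of N t i] tn i by (auto simp: node_ops_eq_wrap wrap_node)
    have jt: "?j = t \<longleftrightarrow> i = (0, 0)"
      using tn i wrap_eq_iff_diff[of N "t - i" t] wrap_uminus_eq_zero[of N i]
      by (auto simp: node_ops_eq_wrap wrap_node)
    have "(\<Sum>e\<in>dirs N. reverse_routing N g t i (nadd N i e)) =
          (\<Sum>e\<in>dirs N. g t (nsub N ?j e) ?j)"
      by (simp add: reverse_routing_def node_ops_eq_wrap algebra_simps)
    moreover have "(\<Sum>e\<in>dirs N. reverse_routing N g t (nsub N i e) i) =
          (\<Sum>e\<in>dirs N. g t ?j (nadd N ?j e))"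
      by (simp add: reverse_routing_def node_ops_eq_wrap algebra_simps)
    ultimately show ?thesis
      using sym_routings_flow[OF g t j] j0 jt tn by auto
  qed
  have link: "reverse_routing N g t i (nadd N i e) =
      g t (nsub N t (nadd N i e)) (nadd N (nsub N t (nadd N i e)) e)" for t i e
    by (simp add: reverse_routing_def node_ops_eq_wrap algebra_simps)
  have sym: "reverse_routing N g t i (nadd N i e) =
        reverse_routing N g (prod.swap t) (prod.swap i) (prod.swap (nadd N i e))"
    "reverse_routing N g t i (nadd N i e) =
        reverse_routing N g (nneg N t) (nneg N i) (nneg N (nadd N i e))"
    if t: "t \<in> displacements N" and e: "e \<in> dirs N" for t i e
  proof -
    obtain a where a: "a \<in> units" "e = wrap N a"
      using e N by (auto simp: dirs_eq_wrap_units)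
    \<comment> \<open>The tail \<open>t - i - a\<close> is exposed as a lift \<open>v\<close> with
      head \<open>v + a\<close>, the form in which the symmetries of \<open>g\<close> apply.\<close>
    have 1: "reverse_routing N g t i (nadd N i e) = g t (wrap N (t - i - a)) (wrap N (t - i - a + a))"
      by (simp add: reverse_routing_def node_ops_eq_wrap a(2) diff_diff_eq)
    show "reverse_routing N g t i (nadd N i e) =
        reverse_routing N g (prod.swap t) (prod.swap i) (prod.swap (nadd N i e))"
      unfolding 1 sym_routings_swap[OF g N t a(1)]
      by (simp add: reverse_routing_def node_ops_eq_wrap swap_wrap swap_plus swap_minus a(2)
          diff_diff_eq)
    show "reverse_routing N g t i (nadd N i e) =
        reverse_routing N g (nneg N t) (nneg N i) (nneg N (nadd N i e))"
      unfolding 1 sym_routings_neg[OF g N t a(1)]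
      by (simp add: reverse_routing_def node_ops_eq_wrap a(2)) (simp add: algebra_simps)
  qed
  have bounds: "0 \<le> reverse_routing N g t i (nadd N i e)" "reverse_routing N g t i (nadd N i e) \<le> 1"
    if "t \<in> displacements N" "e \<in> dirs N" for t i e
    unfolding link using sym_routings_bounds[OF g] that wrap_in_nodes[of N "t - nadd N i e"] N
    by (simp_all add: nsub_eq_wrap)
  show ?thesis
    unfolding sym_routings_def mem_Collect_eq
    by (intro conjI ballI) (assumption | rule flow sym bounds)+
qed

subsection \<open>Flow out of balls\<close>

text \<open>Sum the conservation law over \<open>U\<close>: the source contributes 1 and the
  destination lies outside. Links inside \<open>U\<close> cancel, and the inflow from outside is
  nonnegative.\<close>

lemma cut_outflow:
  assumes g: "g \<in> sym_routings N" and N: "N > 0" and t: "t \<in> displacements N"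
    and U: "U \<subseteq> nodes N" "(0, 0) \<in> U" "t \<notin> U"
  shows "1 \<le> (\<Sum>(i, e) \<in> {(i, e). i \<in> U \<and> e \<in> dirs N \<and> nadd N i e \<notin> U}. g t i (nadd N i e))"
proof -
  let ?D = "dirs N"
  let ?out = "\<lambda>(i, e). g t i (nadd N i e)" and ?in = "\<lambda>(i, e). g t (nsub N i e) i"
  let ?O = "{(i, e). i \<in> U \<and> e \<in> ?D \<and> nadd N i e \<notin> U}"
  let ?I = "{(i, e). i \<in> U \<and> e \<in> ?D \<and> nadd N i e \<in> U}"
  let ?J = "{(i, e). i \<in> U \<and> e \<in> ?D \<and> nsub N i e \<in> U}"
  have fin: "finite U" "finite (U \<times> ?D)"
    using U(1) finite_nodes[of N] finite_dirs[of N] finite_subset by auto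
  have "1 = (\<Sum>i\<in>U. if i = (0, 0) then 1 else if i = t then - 1 else (0 :: real))"
    using U fin by (subst sum.remove[of U "(0, 0)"]) (auto intro: sum.neutral)
  also have "\<dots> = (\<Sum>i\<in>U. (\<Sum>e\<in>?D. g t i (nadd N i e)) - (\<Sum>e\<in>?D. g t (nsub N i e) i))"
    using U(1) by (intro sum.cong refl sym_routings_flow[OF g t, symmetric]) auto
  also have "\<dots> = sum ?out (U \<times> ?D) - sum ?in (U \<times> ?D)"
    by (simp add: sum_subtractf sum.cartesian_product)
  also have "sum ?out (U \<times> ?D) = sum ?out ?O + sum ?out ?I"
    by (subst sum.union_disjoint[symmetric])
      (auto intro!: sum.cong finite_subset[OF _ fin(2)])
  \<comment> \<open>An internal link is outflow at its tail and inflow at its head; the reindexing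
    passes from tail to head.\<close>
  also have "sum ?out ?I = sum ?in ?J"
    using U(1)
    by (intro sum.reindex_bij_witness[where i = "\<lambda>(i, e). (nsub N i e, e)" and j = "\<lambda>(i, e). (nadd N i e, e)"])
      (auto simp: node_ops_eq_wrap wrap_node dest: subsetD)
  also have "sum ?in ?J \<le> sum ?in (U \<times> ?D)"
  proof (intro sum_mono2 fin)
    fix x assume "x \<in> U \<times> ?D - ?J"
    then obtain i e where x: "x = (i, e)" "i \<in> U" "e \<in> ?D"
      by auto
    then have "nadd N (nsub N i e) e = i"
      using U(1) by (simp add: node_ops_eq_wrap wrap_node subsetD)
    then show "?in x \<ge> 0"
      using sym_routings_bounds(1)[OF g t, of "nsub N i e" e] wrap_in_nodes[OF N] x
      by (simp add: nsub_eq_wrap)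
  qed auto
  finally show ?thesis
    by simp
qed

section \<open>Half-spheres and half-balls of the l1 norm\<close>

definition l1 :: "node \<Rightarrow> int" where
  "l1 v = \<bar>fst v\<bar> + \<bar>snd v\<bar>"

text \<open>Exactly the points of the closed l1-ball of radius \<open>m\<close> that a step
  \<open>down\<close> takes out of it.\<close>

definition lower_ring :: "nat \<Rightarrow> node set" where
  "lower_ring m = {v. l1 v = int m \<and> snd v \<le> 0}"

definition lower_diamond :: "nat \<Rightarrow> node set" where
  "lower_diamond r = {v. l1 v < int r \<and> snd v \<le> 0}"

abbreviation down :: node where
  "down \<equiv> (0, -1)"

lemma lower_ring_subset: "lower_ring m \<subseteq> (\<lambda>x. (x, \<bar>x\<bar> - int m)) ` {- int m..int m}"
proof
  fix v assume "v \<in> lower_ring m"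
  then have "v = (fst v, \<bar>fst v\<bar> - int m)" "fst v \<in> {- int m..int m}"
    by (auto simp: lower_ring_def l1_def prod_eq_iff)
  then show "v \<in> (\<lambda>x. (x, \<bar>x\<bar> - int m)) ` {- int m..int m}"
    by blast
qed

lemma finite_lower_ring: "finite (lower_ring m)"
  using lower_ring_subset by (rule finite_subset) simp

lemma card_lower_ring: "card (lower_ring m) \<le> 2 * m + 1"
proof -
  have "card (lower_ring m) \<le> card {- int m..int m}"
    by (rule surj_card_le[OF _ lower_ring_subset]) simp
  then show ?thesis by simp
qed

lemma lower_diamond_0 [simp]: "lower_diamond 0 = {}"
  by (auto simp: lower_diamond_def l1_def)

lemma lower_diamond_Suc: "lower_diamond (Suc r) = lower_ring r \<union> lower_diamond r"
  unfolding lower_diamond_def lower_ring_def by (intro set_eqI) (simp, linarith)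

lemma lower_ring_disjoint: "lower_ring r \<inter> lower_diamond r = {}"
  unfolding lower_diamond_def lower_ring_def by (simp add: disjoint_iff)

lemma finite_lower_diamond: "finite (lower_diamond r)"
  by (induction r) (auto simp: lower_diamond_Suc finite_lower_ring)

text \<open>The half-diamond is the union of the rings of radii 0 to r - 1, and the odd numbers
  below \<open>2 * r\<close> add up to r^2.\<close>

lemma card_lower_diamond: "card (lower_diamond r) \<le> r\<^sup>2"
proof (induction r)
  case (Suc r)
  have "card (lower_diamond (Suc r)) \<le> card (lower_ring r) + card (lower_diamond r)"
    unfolding lower_diamond_Suc by (rule card_Un_le)
  also have "\<dots> \<le> (Suc r)\<^sup>2"
    using Suc card_lower_ring[of r] by (simp add: power2_eq_square)
  finally show ?case .
qed simp

section \<open>Outflow through the downward links\<close>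

lemma sum_union_le:
  fixes h :: "'a \<Rightarrow> real"
  assumes "finite A" "finite B" "\<And>x. x \<in> A \<union> B \<Longrightarrow> h x \<ge> 0"
  shows "sum h (A \<union> B) \<le> sum h A + sum h B"
proof -
  have "sum h (A \<inter> B) \<ge> 0"
    using assms(3) by (intro sum_nonneg) blast
  then show ?thesis
    using sum.union_inter[OF assms(1,2), of h] by linarith
qed

text \<open>The cut is the wrapped ball. Each outgoing link is the image of a downward one under a
  symmetry; swapping fixes \<open>t\<close> and negation sends it to \<open>- t\<close>, so the four
  families of images give the downward sums for \<open>t\<close>, \<open>- t\<close>,
  \<open>t\<close>, \<open>- t\<close>. Half of the unit outflow is left for \<open>t\<close> and
  \<open>- t\<close> together.\<close>

lemma ring_outflow:
  assumes g: "g \<in> sym_routings N" and N: "N \<ge> 2" and t: "t \<in> displacements N"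
    and diag: "prod.swap t = t"
    and far: "\<And>v. l1 v \<le> int m \<Longrightarrow> wrap N v \<noteq> t"
  shows "1 / 2 \<le> (\<Sum>v\<in>lower_ring m. g t (wrap N v) (wrap N (v + down))
                                  + g (nneg N t) (wrap N v) (wrap N (v + down)))"
proof -
  let ?R = "lower_ring m"
  define U where "U = wrap N ` {v. l1 v \<le> int m}"
  define h where "h = (\<lambda>(i, e). g t i (nadd N i e))"
  \<comment> \<open>\<open>F \<phi> v\<close> encodes, as tail and direction, the image under a
    linear \<open>\<phi>\<close> of the link leaving \<open>v\<close> downwards.\<close>
  define F where "F = (\<lambda>\<phi> v. (wrap N (\<phi> v), wrap N (\<phi> (down :: node))))"
  let ?O = "{(i, e). i \<in> U \<and> e \<in> dirs N \<and> nadd N i e \<notin> U}"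
  let ?A = "\<lambda>v. g t (wrap N v) (wrap N (v + down))"
  let ?B = "\<lambda>v. g (nneg N t) (wrap N v) (wrap N (v + down))"
  have nt: "nneg N t \<in> displacements N" "prod.swap (nneg N t) = nneg N t"
    using t N diag by (simp_all add: nneg_displacements) (simp add: nneg_eq_wrap swap_wrap swap_uminus)
  have nnt: "nneg N (nneg N t) = t"
    using t by (simp add: node_ops_eq_wrap wrap_node displacements_in_nodes)
  have du: "down \<in> units" "- down \<in> units" "prod.swap down \<in> units" "prod.swap (- down) \<in> units"
    by (auto simp: units_def)
  have h_nonneg: "h x \<ge> 0" if "x \<in> nodes N \<times> dirs N" for x
    using that sym_routings_bounds(1)[OF g t] by (auto simp: h_def)
  have F_in: "F \<phi> v \<in> nodes N \<times> dirs N"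
    if "\<phi> down \<in> units" for \<phi> v
    using that N by (simp add: F_def wrap_in_nodes dirs_eq_wrap_units)
  have hF: "h x \<ge> 0" if "x \<in> F id ` ?R \<union> F uminus ` ?R \<union>
      (F prod.swap ` ?R \<union> F (\<lambda>v. prod.swap (- v)) ` ?R)" for x
    using that F_in[of id] F_in[of uminus] F_in[of prod.swap] F_in[of "\<lambda>v. prod.swap (- v)"] du
    by (elim UnE imageE) (simp_all only: h_nonneg id_apply)
  text \<open>The four rotated half-rings only need to cover the outgoing links; they may overlap after
    wrapping, as they do for N = 2.\<close>
  have cover: "?O \<subseteq> F id ` ?R \<union> F uminus ` ?R \<union> (F prod.swap ` ?R \<union> F (\<lambda>v. prod.swap (- v)) ` ?R)"
  proof (rule subrelI)
    fix i e assume "(i, e) \<in> ?O"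
    then have "i \<in> U" "e \<in> dirs N" "nadd N i e \<notin> U"
      by auto
    then obtain v a where v: "l1 v \<le> int m" "i = wrap N v" and a: "a \<in> units" "e = wrap N a"
      using N unfolding U_def dirs_eq_wrap_units[OF N] by blast
    have va: "\<not> l1 (v + a) \<le> int m"
      using \<open>nadd N i e \<notin> U\<close> by (auto simp: v a U_def node_ops_eq_wrap)
    have *: "(i, e) \<in> F \<phi> ` ?R" if "w \<in> ?R" "v = \<phi> w" "a = \<phi> down" for \<phi> w
      using that v a by (auto simp: F_def)
    \<comment> \<open>A unit step changes \<open>l1\<close> by one, so it leaves the ball only from
      the sphere and only by moving its coordinate away from 0; the direction thus tells which image
      of the half-ring contains the tail.\<close>
    from a(1) v(1) va
    consider "a = down" "v \<in> ?R" | "a = - down" "- v \<in> ?R"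
      | "a = prod.swap down" "prod.swap v \<in> ?R" | "a = prod.swap (- down)" "- prod.swap v \<in> ?R"
      unfolding units_def lower_ring_def l1_def by (auto simp: abs_if split: if_splits)
    then show "(i, e) \<in> F id ` ?R \<union> F uminus ` ?R \<union>
        (F prod.swap ` ?R \<union> F (\<lambda>v. prod.swap (- v)) ` ?R)"
      using *[of v id] *[of "- v" uminus] *[of "prod.swap v" prod.swap]
        *[of "- prod.swap v" "\<lambda>v. prod.swap (- v)"]
      by cases auto
  qed
  have "U \<subseteq> nodes N" "t \<notin> U"
    using far N by (auto simp: U_def wrap_in_nodes)
  moreover have "wrap N (0, 0) \<in> U"
    unfolding U_def by (rule imageI) (simp add: l1_def)
  then have "(0, 0) \<in> U"
    by (simp add: wrap_def)
  ultimately have "1 \<le> sum h ?O"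
    unfolding h_def using N by (intro cut_outflow[OF g _ t]) auto
  also have "\<dots> \<le> sum h (F id ` ?R \<union> F uminus ` ?R \<union> (F prod.swap ` ?R \<union> F (\<lambda>v. prod.swap (- v)) ` ?R))"
    using cover hF by (intro sum_mono2) (blast intro: finite_lower_ring)+
  also have "\<dots> \<le> sum h (F id ` ?R \<union> F uminus ` ?R) +
                  sum h (F prod.swap ` ?R \<union> F (\<lambda>v. prod.swap (- v)) ` ?R)"
    using hF by (intro sum_union_le) (blast intro: finite_lower_ring)+
  also have "\<dots> \<le> (sum h (F id ` ?R) + sum h (F uminus ` ?R)) +
                  (sum h (F prod.swap ` ?R) + sum h (F (\<lambda>v. prod.swap (- v)) ` ?R))"
    using hF by (intro add_mono sum_union_le) (blast intro: finite_lower_ring)+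
  \<comment> \<open>After wrapping, \<open>F \<phi>\<close> may merge links of the ring, so only an
    inequality is available.\<close>
  also have "\<dots> \<le> (sum (h \<circ> F id) ?R + sum (h \<circ> F uminus) ?R) +
                  (sum (h \<circ> F prod.swap) ?R + sum (h \<circ> F (\<lambda>v. prod.swap (- v))) ?R)"
    using hF by (intro add_mono sum_image_le finite_lower_ring) blast+
  also have "h \<circ> F id = ?A"
    by (simp add: h_def F_def fun_eq_iff node_ops_eq_wrap)
  also have "h \<circ> F uminus = ?B"
    unfolding sym_routings_neg[OF g N nt(1) du(1)] nnt
    by (simp add: h_def F_def fun_eq_iff node_ops_eq_wrap)
  also have "h \<circ> F prod.swap = ?A"
    unfolding sym_routings_swap[OF g N t du(1)] diag
    by (simp add: h_def F_def fun_eq_iff node_ops_eq_wrap swap_plus)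
  also have "h \<circ> F (\<lambda>v. prod.swap (- v)) = ?B"
    unfolding sym_routings_swap[OF g N nt(1) du(1)] nt(2)
    unfolding swap_plus sym_routings_neg[OF g N nt(1) du(3)] nnt
    by (simp add: h_def F_def fun_eq_iff node_ops_eq_wrap swap_plus swap_uminus)
  finally show ?thesis
    by (simp add: sum.distrib)
qed

text \<open>Each of the disjoint rings of radii 0 to r - 1 contributes at least 1/2.\<close>

lemma diamond_outflow:
  assumes g: "g \<in> sym_routings N" and N: "N \<ge> 2" and t: "t \<in> displacements N"
    and diag: "prod.swap t = t"
    and far: "\<And>v. l1 v < int r \<Longrightarrow> wrap N v \<noteq> t"
  shows "real r / 2 \<le> (\<Sum>v\<in>lower_diamond r. g t (wrap N v) (wrap N (v + down))
                                  + g (nneg N t) (wrap N v) (wrap N (v + down)))"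
  using far
proof (induction r)
  case (Suc r)
  then have "real r / 2 \<le> (\<Sum>v\<in>lower_diamond r. g t (wrap N v) (wrap N (v + down))
                                  + g (nneg N t) (wrap N v) (wrap N (v + down)))"
    by auto
  moreover have "1 / 2 \<le> (\<Sum>v\<in>lower_ring r. g t (wrap N v) (wrap N (v + down))
                                  + g (nneg N t) (wrap N v) (wrap N (v + down)))"
    using Suc.prems by (intro ring_outflow g N t diag) auto
  ultimately show ?case
    unfolding lower_diamond_Suc
    by (subst sum.union_disjoint)
      (auto simp: finite_lower_ring finite_lower_diamond lower_ring_disjoint add_divide_distrib)
qed simp

subsection \<open>The traffic matrix and the load it creates\<close>

lemma antipode_in_displacements: "N \<ge> 2 \<Longrightarrow> antipode N \<in> displacements N"
  by (auto simp: antipode_def displacements_def nodes_def)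

text \<open>In each coordinate, an integer congruent to \<open>N div 2\<close> but smaller in
  absolute value would differ from it by a nonzero amount below \<open>N\<close>.\<close>

lemma wrap_eq_antipode_imp:
  assumes "wrap N v = wrap N (antipode N)" "N > 0"
  shows "2 * (int N div 2) \<le> l1 v"
proof -
  have "int N div 2 \<le> \<bar>x\<bar>" if "int N dvd x - int N div 2" for x
  proof (rule ccontr)
    assume "\<not> ?thesis"
    then have "\<bar>x - int N div 2\<bar> < int N" "x - int N div 2 \<noteq> 0"
      using \<open>N > 0\<close> by auto
    then show False
      using that dvd_imp_le_int[of "x - int N div 2" "int N"] by linarith
  qed
  from this[of "fst v"] this[of "snd v"] show ?thesis
    using assms(1) by (simp add: wrap_eq_iff antipode_def l1_def)
qed

lemma l1_uminus [simp]: "l1 (- v) = l1 v"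
  by (simp add: l1_def)

text \<open>Points of the half-diamond differ by less than \<open>2 * r\<close>, hence by less than
  \<open>N\<close>, in each coordinate.\<close>

lemma inj_wrap_lower_diamond:
  assumes "2 * r \<le> N"
  shows "inj_on (\<lambda>v. wrap N (v + c)) (lower_diamond r)"
proof (rule inj_onI)
  fix u v assume uv: "u \<in> lower_diamond r" "v \<in> lower_diamond r" "wrap N (u + c) = wrap N (v + c)"
  have "\<bar>fst u - fst v\<bar> < int N" "\<bar>snd u - snd v\<bar> < int N"
    using uv(1,2) assms by (auto simp: lower_diamond_def l1_def)
  moreover have "int N dvd fst u - fst v" "int N dvd snd u - snd v"
    using uv(3) by (simp_all add: wrap_add_cancel wrap_eq_iff)
  ultimately have "fst u - fst v = 0" "snd u - snd v = 0"
    using dvd_imp_le_int[of "fst u - fst v" "int N"] dvd_imp_le_int[of "snd u - snd v" "int N"]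
    by linarith+
  then show "u = v"
    by (simp add: prod_eq_iff)
qed

definition sources :: "nat \<Rightarrow> nat \<Rightarrow> node set" where
  "sources N r = (\<lambda>v. wrap N (- v)) ` lower_diamond r"

text \<open>Reversal replaces a node by destination minus node. With destination
  \<open>v + down\<close>, the link from (0, 0) to \<open>down\<close> becomes the one from
  \<open>v\<close> to \<open>v + down\<close>, as in the outflow bound.\<close>

definition sinks :: "nat \<Rightarrow> nat \<Rightarrow> node set" where
  "sinks N r = (\<lambda>v. wrap N (v + down)) ` lower_diamond r"

text \<open>For even \<open>N\<close> both indicators hold together and the entry is 1; for odd
  \<open>N \<ge> 3\<close> there are two separate entries of 1/2.\<close>

definition diamond_traffic :: "nat \<Rightarrow> nat \<Rightarrow> node \<Rightarrow> node \<Rightarrow> real" where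
  "diamond_traffic N r s u =
     (if s \<in> nodes N \<and> (s \<in> sources N r \<or> u \<in> sinks N r)
      then (of_bool (u = nadd N s (antipode N)) + of_bool (u = nsub N s (antipode N))) / 2
      else 0)"

text \<open>The weight \<open>h\<close> is 1 for row sums and a link fraction for loads. If
  \<open>t\<close> and \<open>- t\<close> coincide, both halves fall on one entry, so the formula
  covers both parities.\<close>

lemma sum_diamond_traffic:
  fixes h :: "node \<Rightarrow> real"
  assumes N: "N \<ge> 2" and s: "s \<in> nodes N"
  defines "t \<equiv> antipode N"
  shows "(\<Sum>u\<in>displacements N. diamond_traffic N r s (nadd N s u) * h u) =
           (of_bool (s \<in> sources N r \<or> nadd N s t \<in> sinks N r) * h t +
            of_bool (s \<in> sources N r \<or> nsub N s t \<in> sinks N r) * h (nneg N t)) / 2"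
proof -
  have t: "t \<in> displacements N" "nneg N t \<in> displacements N"
    using N antipode_in_displacements nneg_displacements unfolding t_def by auto
  have cancel: "nadd N s u = nadd N s w \<longleftrightarrow> u = w"
    if "u \<in> displacements N" "w \<in> displacements N" for u w
    using wrap_add_cancel[of N u s w] that
    by (simp add: nadd_eq_wrap wrap_node displacements_in_nodes add.commute)
  have nsub: "nsub N s t = nadd N s (nneg N t)"
    by (simp add: node_ops_eq_wrap)
  have "diamond_traffic N r s (nadd N s u) * h u =
        (if u = t then of_bool (s \<in> sources N r \<or> nadd N s t \<in> sinks N r) * h t / 2 else 0) +
        (if u = nneg N t then of_bool (s \<in> sources N r \<or> nsub N s t \<in> sinks N r) * h (nneg N t) / 2 else 0)"
    if u: "u \<in> displacements N" for u
  proof -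
    have "diamond_traffic N r s (nadd N s u) = of_bool (s \<in> sources N r \<or> nadd N s u \<in> sinks N r) *
        ((of_bool (u = t) + of_bool (u = nneg N t)) / 2)"
      using s by (simp add: diamond_traffic_def t_def[symmetric] nsub cancel[OF u] t)
    then show ?thesis
      unfolding nsub by (cases "u = t"; cases "u = nneg N t") simp_all
  qed
  then have "(\<Sum>u\<in>displacements N. diamond_traffic N r s (nadd N s u) * h u) =
      (\<Sum>u\<in>displacements N.
        (if u = t then of_bool (s \<in> sources N r \<or> nadd N s t \<in> sinks N r) * h t / 2 else 0) +
        (if u = nneg N t then of_bool (s \<in> sources N r \<or> nsub N s t \<in> sinks N r) * h (nneg N t) / 2 else 0))"
    by (intro sum.cong refl)
  also have "\<dots> = (of_bool (s \<in> sources N r \<or> nadd N s t \<in> sinks N r) * h t +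
            of_bool (s \<in> sources N r \<or> nsub N s t \<in> sinks N r) * h (nneg N t)) / 2"
    using t by (simp add: sum.distrib sum.delta finite_displacements add_divide_distrib)
  finally show ?thesis .
qed

lemma sources_subset_nodes: "N > 0 \<Longrightarrow> sources N r \<subseteq> nodes N"
  by (auto simp: sources_def wrap_in_nodes)

lemma shifted_sinks:
  assumes "N > 0"
  shows "{s \<in> nodes N. wrap N (s + c) \<in> sinks N r} = (\<lambda>v. wrap N (v + (down - c))) ` lower_diamond r"
proof (intro set_eqI iffI)
  fix s assume "s \<in> {s \<in> nodes N. wrap N (s + c) \<in> sinks N r}"
  then obtain v where v: "v \<in> lower_diamond r" "s \<in> nodes N" "wrap N (s + c) = wrap N (v + down)"
    by (auto simp: sinks_def)
  then have "s = wrap N (wrap N (v + down) - c)"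
    by (metis wrap_node wrap_wrap(4) add_diff_cancel)
  then show "s \<in> (\<lambda>v. wrap N (v + (down - c))) ` lower_diamond r"
    using v(1) by (auto simp: add_diff_eq)
next
  fix s assume "s \<in> (\<lambda>v. wrap N (v + (down - c))) ` lower_diamond r"
  then obtain v where "v \<in> lower_diamond r" "s = wrap N (v + (down - c))"
    by blast
  then show "s \<in> {s \<in> nodes N. wrap N (s + c) \<in> sinks N r}"
    using assms by (simp add: sinks_def wrap_in_nodes add_diff_eq)
qed

lemma sum_shifted_sinks:
  fixes h :: "node \<Rightarrow> real"
  assumes "N > 0" "2 * r \<le> N"
  shows "(\<Sum>s\<in>nodes N. of_bool (wrap N (s + c) \<in> sinks N r) * h s) =
         (\<Sum>v\<in>lower_diamond r. h (wrap N (v + (down - c))))"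
proof -
  have "(\<Sum>s\<in>nodes N. of_bool (wrap N (s + c) \<in> sinks N r) * h s) =
        (\<Sum>s \<in> {s \<in> nodes N. wrap N (s + c) \<in> sinks N r}. h s)"
    by (intro sum.mono_neutral_cong_right) (auto simp: finite_nodes)
  also have "\<dots> = (\<Sum>v\<in>lower_diamond r. h (wrap N (v + (down - c))))"
    unfolding shifted_sinks[OF assms(1)]
    by (simp add: sum.reindex[OF inj_wrap_lower_diamond[OF assms(2)]])
  finally show ?thesis .
qed

lemma sum_sources:
  fixes h :: "node \<Rightarrow> real"
  assumes "N > 0" "2 * r \<le> N"
  shows "(\<Sum>s\<in>nodes N. of_bool (s \<in> sources N r) * h s) =
         (\<Sum>v\<in>lower_diamond r. h (wrap N (- v)))"
proof -
  have "inj_on (\<lambda>v. wrap N (- v)) (lower_diamond r)"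
    using inj_wrap_lower_diamond[OF assms(2), of 0]
    by (auto simp: inj_on_def wrap_eq_iff)
  moreover have "(\<Sum>s\<in>nodes N. of_bool (s \<in> sources N r) * h s) = (\<Sum>s \<in> sources N r. h s)"
    using sources_subset_nodes[OF assms(1)]
    by (intro sum.mono_neutral_cong_right) (auto simp: finite_nodes)
  ultimately show ?thesis
    by (simp add: sources_def sum.reindex)
qed

text \<open>Every row and column holds at most two halves. In total, each source sends at most 1,
  each sink receives at most 1/2 from either of two origins, and there are at most r^2 of each
  kind.\<close>

lemma diamond_traffic_in_traffic:
  assumes N: "N \<ge> 2" and r: "2 * r \<le> N"
  shows "diamond_traffic N r \<in> traffic N (2 * r\<^sup>2)"
proof -
  let ?d = "diamond_traffic N r" and ?t = "antipode N"
  have t: "?t \<in> displacements N" "nneg N ?t \<in> displacements N"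
    using N antipode_in_displacements nneg_displacements by auto
  have row: "(\<Sum>u\<in>displacements N. ?d s (nadd N s u)) =
           (of_bool (s \<in> sources N r \<or> wrap N (s + ?t) \<in> sinks N r) +
            of_bool (s \<in> sources N r \<or> wrap N (s + - ?t) \<in> sinks N r)) / 2"
    if "s \<in> nodes N" for s
    using sum_diamond_traffic[OF N that, of r "\<lambda>_. 1"] by (simp add: node_ops_eq_wrap)
  have "(\<Sum>u\<in>displacements N. ?d (nsub N s u) s) \<le> 1" if s: "s \<in> nodes N" for s
  proof -
    have "s = nadd N (nsub N s u) ?t \<longleftrightarrow> u = ?t" "s = nsub N (nsub N s u) ?t \<longleftrightarrow> u = nneg N ?t"
      if "u \<in> displacements N" for u
    proof -
      have "wrap N s = wrap N (s - u + c) \<longleftrightarrow> wrap N u = wrap N c" for c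
        by (auto simp: wrap_eq_iff algebra_simps dvd_diff_commute)
      from this[of ?t] this[of "- ?t"]
      show "s = nadd N (nsub N s u) ?t \<longleftrightarrow> u = ?t" "s = nsub N (nsub N s u) ?t \<longleftrightarrow> u = nneg N ?t"
        using that t(1) s by (simp_all add: node_ops_eq_wrap wrap_node displacements_in_nodes)
    qed
    then have "(\<Sum>u\<in>displacements N. ?d (nsub N s u) s) \<le>
        (\<Sum>u\<in>displacements N. (if u = ?t then 1 / 2 else 0) + (if u = nneg N ?t then 1 / 2 else 0))"
      by (intro sum_mono) (auto simp: diamond_traffic_def)
    also have "\<dots> \<le> 1"
      using t by (simp add: sum.distrib sum.delta finite_displacements)
    finally show ?thesis .
  qed
  moreover have "(\<Sum>s\<in>nodes N. \<Sum>u\<in>displacements N. ?d s (nadd N s u)) \<le> real (2 * r\<^sup>2)"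
  proof -
    have "(\<Sum>s\<in>nodes N. \<Sum>u\<in>displacements N. ?d s (nadd N s u)) \<le>
      (\<Sum>s\<in>nodes N. of_bool (s \<in> sources N r) * 1 + of_bool (wrap N (s + ?t) \<in> sinks N r) * (1 / 2)
           + of_bool (wrap N (s + - ?t) \<in> sinks N r) * (1 / 2))"
      by (intro sum_mono) (simp add: row)
    also have "\<dots> = real (2 * card (lower_diamond r))"
      using N by (simp only: sum.distrib sum_sources[OF _ r] sum_shifted_sinks[OF _ r]) simp
    also have "\<dots> \<le> real (2 * r\<^sup>2)"
      using card_lower_diamond[of r] by linarith
    finally show ?thesis .
  qed
  ultimately show ?thesis
    unfolding traffic_def by (auto simp: row) (simp add: diamond_traffic_def)
qed

section \<open>The load of the link from (0, 0) to (0, -1)\<close>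

lemma max_load_ge:
  assumes "i \<in> nodes N" "e \<in> dirs N"
  shows "link_load N g d i e \<le> max_load N g d"
proof -
  have "{link_load N g d i e | i e. i \<in> nodes N \<and> e \<in> dirs N} =
      (\<lambda>(i, e). link_load N g d i e) ` (nodes N \<times> dirs N)"
    by auto
  then show ?thesis
    unfolding max_load_def using assms by (intro Max_ge) (auto simp: finite_nodes finite_dirs)
qed

text \<open>The load is the mean of two outflows, that of \<open>g\<close> from the sources and that
  of its reversal from the sinks; each is at least r/2.\<close>

lemma max_load_diamond_traffic:
  assumes N: "N \<ge> 2" and r: "2 * r \<le> N" and g: "g \<in> sym_routings N"
  shows "real r / 2 \<le> max_load N g (diamond_traffic N r)"
proof -
  let ?d = "diamond_traffic N r" and ?L = "lower_diamond r"
  define t where "t = antipode N"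
  let ?t' = "nneg N t"
  define e where "e = nneg N (0, 1)"
  \<comment> \<open>\<open>G u s\<close> is the share of the traffic from \<open>s\<close> with
    displacement \<open>u\<close> that the fixed link carries.\<close>
  define G where "G = (\<lambda>u s. g u (nsub N (0, 0) s) (nadd N (nsub N (0, 0) s) e))"
  let ?out = "\<lambda>g. \<Sum>v\<in>?L. g t (wrap N v) (wrap N (v + down)) + g ?t' (wrap N v) (wrap N (v + down))"
  have t: "t \<in> displacements N" "prod.swap t = t"
    using antipode_in_displacements[OF N] by (auto simp: t_def antipode_def)
  have t': "wrap N t = t" "wrap N (- t) = ?t'"
    using t(1) by (simp_all add: wrap_node displacements_in_nodes nneg_eq_wrap)
  have e: "e = wrap N down"
    by (simp add: e_def node_ops_eq_wrap)
  have G: "G u (wrap N (- v)) = g u (wrap N v) (wrap N (v + down))" for u v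
    by (simp add: G_def e node_ops_eq_wrap zero_prod_def[symmetric] add.commute)
  \<comment> \<open>\<open>v + down - c\<close> is the origin from which displacement
    \<open>c\<close> reaches the sink \<open>v + down\<close>.\<close>
  have Gneg: "G u (wrap N (v + (down - c))) = reverse_routing N g (wrap N c) (wrap N v) (wrap N (v + down))"
    if "u = wrap N c" for u v c
    using that
    by (simp add: G_def e node_ops_eq_wrap zero_prod_def[symmetric] reverse_routing_def)
      (simp add: algebra_simps)
  \<comment> \<open>The radius is \<open>2 * r\<close> because \<open>disj\<close> adds two points
    of the half-diamond.\<close>
  have short: "wrap N v \<noteq> wrap N t" if "l1 v < 2 * int r" for v
  proof
    have "int r \<le> int N div 2"
      using r by linarith
    moreover assume "wrap N v = wrap N t"
    ultimately show False
      using wrap_eq_antipode_imp[of N v] N that by (simp add: t_def)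
  qed
  have far: "wrap N v \<noteq> t" if "l1 v < int r" for v
    using short[of v] that t(1) by (auto simp: wrap_node displacements_in_nodes l1_def)
  \<comment> \<open>A pair with both a source and a sink would count once in the traffic but twice
    in the split sum. It would make \<open>v + w + down\<close> a lift of \<open>t\<close> or
    \<open>- t\<close>, yet the norm of this vector is at most \<open>2 * r - 1\<close>.\<close>
  have disj: "\<not> (s \<in> sources N r \<and> wrap N (s + c) \<in> sinks N r)" if c: "c = t \<or> c = - t" for s c
  proof
    assume "s \<in> sources N r \<and> wrap N (s + c) \<in> sinks N r"
    then obtain v w where v: "v \<in> ?L" "s = wrap N (- v)" and w: "w \<in> ?L" "wrap N (s + c) = wrap N (w + down)"
      unfolding sources_def sinks_def by blast
    then have "wrap N (- v + c) = wrap N (w + down)"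
      by simp
    then have "wrap N (v + w + down) = wrap N c"
      by (auto simp: wrap_eq_iff algebra_simps dvd_diff_commute)
    moreover from this have "wrap N (- (v + w + down)) = wrap N (- c)"
      by (metis wrap_wrap(6))
    moreover have "l1 (v + w + down) < 2 * int r"
      using v(1) w(1) by (auto simp: lower_diamond_def l1_def)
    ultimately show False
      using c short[of "v + w + down"] short[of "- (v + w + down)"]
      by (metis l1_uminus minus_minus)
  qed
  have "link_load N g ?d (0, 0) e =
      (\<Sum>s\<in>nodes N. (of_bool (s \<in> sources N r \<or> nadd N s t \<in> sinks N r) * G t s +
            of_bool (s \<in> sources N r \<or> nsub N s t \<in> sinks N r) * G ?t' s) / 2)"
    unfolding link_load_def G_def t_def
    by (intro sum.cong refl sum_diamond_traffic[OF N])
  also have "\<dots> = (\<Sum>s\<in>nodes N. (of_bool (s \<in> sources N r) * (G t s + G ?t' s) +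
        of_bool (wrap N (s + t) \<in> sinks N r) * G t s +
        of_bool (wrap N (s + - t) \<in> sinks N r) * G ?t' s) / 2)"
  proof (intro sum.cong refl)
    fix s
    show "(of_bool (s \<in> sources N r \<or> nadd N s t \<in> sinks N r) * G t s +
            of_bool (s \<in> sources N r \<or> nsub N s t \<in> sinks N r) * G ?t' s) / 2 =
        (of_bool (s \<in> sources N r) * (G t s + G ?t' s) +
        of_bool (wrap N (s + t) \<in> sinks N r) * G t s +
        of_bool (wrap N (s + - t) \<in> sinks N r) * G ?t' s) / 2"
      using disj[of t s] disj[of "- t" s] by (auto simp: node_ops_eq_wrap)
  qed
  also have "\<dots> = ((\<Sum>s\<in>nodes N. of_bool (s \<in> sources N r) * (G t s + G ?t' s)) +
        (\<Sum>s\<in>nodes N. of_bool (wrap N (s + t) \<in> sinks N r) * G t s) +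
        (\<Sum>s\<in>nodes N. of_bool (wrap N (s + - t) \<in> sinks N r) * G ?t' s)) / 2"
    by (simp only: sum_divide_distrib[symmetric] sum.distrib)
  \<comment> \<open>At the sinks, displacement \<open>t\<close> gives the first summand of the
    reversed outflow and \<open>- t\<close> the second.\<close>
  also have "\<dots> = (?out g + ?out (reverse_routing N g)) / 2"
    using N Gneg[of t t] Gneg[of ?t' "- t"] t'
    by (subst sum_sources[OF _ r] sum_shifted_sinks[OF _ r], simp)+ (simp add: G sum.distrib)
  also have "\<dots> \<ge> real r / 2"
    using diamond_outflow[OF g N t, of r] far
      diamond_outflow[OF reverse_routing_in_sym_routings[OF g N] N t, of r]
    by simp
  finally have "real r / 2 \<le> link_load N g ?d (0, 0) e" .
  also have "\<dots> \<le> max_load N g ?d"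
    using N by (intro max_load_ge) (auto simp: e_def dirs_def nodes_def)
  finally show ?thesis .
qed

subsection \<open>Split-Diamond traffic\<close>

lemma min_mod_uminus:
  fixes a n :: int
  assumes "2 * \<bar>a\<bar> \<le> n" "n > 0"
  shows "min (a mod n) (- a mod n) = \<bar>a\<bar>"
proof -
  have *: "min (b mod n) (- b mod n) = b" if "0 \<le> b" "2 * b \<le> n" for b
  proof -
    have "b mod n = b"
      using that assms(2) by (intro mod_pos_pos_trivial) auto
    then show ?thesis
      using that by (auto simp: zmod_zminus1_eq_if)
  qed
  show ?thesis
    using *[of a] *[of "- a"] assms(1) by (cases "a \<ge> 0") (auto simp: min.commute)
qed

text \<open>Offsets of at most N/2 per coordinate are shortest representatives, so torus balls can
  be treated as l1-balls of integer vectors.\<close>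

lemma torus_dist_wrap:
  assumes "2 * \<bar>fst v\<bar> \<le> int N" "2 * \<bar>snd v\<bar> \<le> int N" "N > 0"
  shows "torus_dist N (wrap N (u + v)) u = l1 v"
proof -
  have "((a + b) mod int N - a) mod int N = b mod int N"
    "(a - (a + b) mod int N) mod int N = - b mod int N" for a b
    by (simp_all add: mod_simps)
  then show ?thesis
    using assms by (simp add: torus_dist_def wrap_def l1_def min_mod_uminus)
qed

text \<open>Around 0 the bound on the second coordinate keeps the half-ball of nonnegative height,
  whose negative is the lower half-diamond; by \<open>2 * r \<le> N\<close> the heights stay below
  N/2.\<close>

lemma half_diamond1_eq_sources:
  assumes "even N" "N > 0" "2 * r \<le> N"
  shows "half_diamond1 N r = sources N r"
proof (intro set_eqI iffI)
  fix s assume s: "s \<in> half_diamond1 N r"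
  \<comment> \<open>A shortest lift of \<open>s\<close>: only the first coordinate can exceed
    N/2.\<close>
  define v where "v = (if fst s \<le> int N div 2 then fst s else fst s - int N, snd s)"
  have b: "0 \<le> fst s" "fst s < int N" "0 \<le> snd s" "snd s \<le> int N div 2 - 1"
    using s by (auto simp: half_diamond1_def nodes_def)
  have "s = wrap N v"
    using b by (auto simp: v_def wrap_def prod_eq_iff)
  moreover have "torus_dist N (wrap N ((0, 0) + v)) (0, 0) = l1 v"
    using b assms(2) by (intro torus_dist_wrap) (auto simp: v_def)
  ultimately have "l1 v < int r"
    using s by (simp add: half_diamond1_def zero_prod_def[symmetric])
  then have "- v \<in> lower_diamond r"
    using b by (simp add: lower_diamond_def) (simp add: v_def)
  then show "s \<in> sources N r"
    using \<open>s = wrap N v\<close> by (force simp: sources_def)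
next
  fix s assume "s \<in> sources N r"
  then obtain v where v: "v \<in> lower_diamond r" "s = wrap N (- v)"
    by (auto simp: sources_def)
  then have b: "\<bar>fst v\<bar> + \<bar>snd v\<bar> < int r" "snd v \<le> 0" "int r \<le> int N div 2"
    using assms(3) by (auto simp: lower_diamond_def l1_def)
  have "torus_dist N (wrap N ((0, 0) + - v)) (0, 0) = l1 (- v)"
    using b assms(2) by (intro torus_dist_wrap) auto
  moreover have "snd s = - snd v"
    using b v(2) by (simp add: wrap_def)
  ultimately show "s \<in> half_diamond1 N r"
    using v b assms(2) by (simp add: half_diamond1_def wrap_in_nodes zero_prod_def[symmetric] l1_def)
qed

lemma wrap_add_twice_antipode:
  assumes "even N"
  shows "wrap N (v + antipode N + antipode N) = wrap N v"
  using assms by (auto simp: wrap_eq_iff antipode_def elim!: evenE)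

text \<open>Such a node is \<open>t + v\<close> with \<open>l1 v \<le> r\<close> and
  \<open>snd v \<le> -1\<close>, and its destination is \<open>v\<close> because
  \<open>2 * t\<close> wraps to 0. Undoing one step \<open>down\<close> gives norm below
  \<open>r\<close> and height at most 0, which is why this half-diamond is closed and the first one
  open.\<close>

lemma half_diamond2_iff_sinks:
  assumes "even N" "N > 0" "2 * r \<le> N" "s \<in> nodes N"
  shows "s \<in> half_diamond2 N r \<longleftrightarrow> nadd N s (antipode N) \<in> sinks N r"
proof
  assume s: "s \<in> half_diamond2 N r"
  define v where "v = s - antipode N"
  have sv: "s = antipode N + v"
    by (simp add: v_def)
  have b: "2 * \<bar>fst v\<bar> \<le> int N" "2 * \<bar>snd v\<bar> \<le> int N" "snd v \<le> -1"
    using s dvd_mult_div_cancel[of 2 "int N"] assms(1)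
    by (auto simp: half_diamond2_def nodes_def v_def antipode_def abs_le_iff)
  have "torus_dist N (wrap N (antipode N + v)) (antipode N) = l1 v"
    using b assms(2) by (intro torus_dist_wrap) auto
  then have "l1 v \<le> int r"
    using s by (simp add: half_diamond2_def sv[symmetric] wrap_node)
  then have "v - down \<in> lower_diamond r"
    using b by (auto simp: lower_diamond_def l1_def)
  moreover have "wrap N (s + antipode N) = wrap N (v - down + down)"
    using wrap_add_twice_antipode[OF assms(1), of v] by (simp add: sv add_ac)
  ultimately show "nadd N s (antipode N) \<in> sinks N r"
    unfolding sinks_def nadd_eq_wrap by blast
next
  assume "nadd N s (antipode N) \<in> sinks N r"
  then obtain w where w: "w \<in> lower_diamond r" "wrap N (s + antipode N) = wrap N (w + down)"
    unfolding sinks_def nadd_eq_wrap by blast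
  define v where "v = w + down"
  have b: "\<bar>fst v\<bar> + \<bar>snd v\<bar> \<le> int r" "snd v \<le> -1" "int r \<le> int N div 2"
    using w(1) assms(3) by (auto simp: v_def lower_diamond_def l1_def)
  have "wrap N (wrap N (s + antipode N) + antipode N) = wrap N (antipode N + v)"
    unfolding w(2) by (simp add: v_def add_ac)
  then have s: "s = wrap N (antipode N + v)"
    using wrap_add_twice_antipode[OF assms(1), of s] assms(4) by (simp add: wrap_node)
  have "torus_dist N s (antipode N) = l1 v"
    unfolding s using b assms(2) by (intro torus_dist_wrap) auto
  moreover have "snd s = int N div 2 + snd v"
    using b unfolding s by (simp add: wrap_def antipode_def)
  ultimately show "s \<in> half_diamond2 N r"
    using b assms(4) by (simp add: half_diamond2_def l1_def)
qed

lemma diamond_traffic_eq_split_diamond: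
  assumes "even N" "N > 0" "2 * r \<le> N"
  shows "diamond_traffic N r = split_diamond N r"
proof (intro ext)
  fix s u
  have same: "nsub N s (antipode N) = nadd N s (antipode N)"
    using wrap_add_twice_antipode[OF assms(1), of "s - antipode N"] by (simp add: node_ops_eq_wrap)
  have nodes: "s \<in> nodes N" if "s \<in> half_diamond1 N r \<union> half_diamond2 N r"
    using that by (auto simp: half_diamond1_def half_diamond2_def)
  have iff: "s \<in> half_diamond1 N r \<union> half_diamond2 N r \<longleftrightarrow>
      s \<in> sources N r \<or> nadd N s (antipode N) \<in> sinks N r" if "s \<in> nodes N"
    using half_diamond1_eq_sources[OF assms] half_diamond2_iff_sinks[OF assms that] by simp
  show "diamond_traffic N r s u = split_diamond N r s u"
  proof (cases "s \<in> nodes N \<and> u = nadd N s (antipode N)")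
    case True
    then show ?thesis
      using iff by (simp add: diamond_traffic_def split_diamond_def same)
  next
    case False
    then show ?thesis
      using nodes by (auto simp: diamond_traffic_def split_diamond_def same)
  qed
qed

section \<open>Perfect squares and the final bounds\<close>

text \<open>An even square has an even root \<open>2 * r\<close>. This \<open>r\<close> is the
  radius, and \<open>2 * r\<^sup>2\<close> is the total allowed for the diamond traffic.\<close>

lemma is_square_double_iff: "is_square (2 * k) \<longleftrightarrow> (\<exists>r. k = 2 * r\<^sup>2)" for k :: nat
proof
  assume "is_square (2 * k)"
  then obtain m where m: "2 * k = m\<^sup>2"
    by (auto elim: is_nth_powerE)
  then have "even (m\<^sup>2)"
    by (metis dvd_triv_left)
  then obtain r where "m = 2 * r"
    by (auto elim: evenE)
  with m show "\<exists>r. k = 2 * r\<^sup>2"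
    by (auto simp: power2_eq_square)
next
  assume "\<exists>r. k = 2 * r\<^sup>2"
  then obtain r where "2 * k = (2 * r)\<^sup>2"
    by (auto simp: power2_eq_square)
  then show "is_square (2 * k)"
    by (metis is_nth_power_nth_power)
qed

lemma sqrt_double: "sqrt (2 * real (2 * r\<^sup>2)) / 4 = real r / 2"
proof -
  have "sqrt (2 * real (2 * r\<^sup>2)) = sqrt ((2 * real r)\<^sup>2)"
    by (simp add: power2_eq_square)
  then show ?thesis
    by (simp only: real_sqrt_abs)
qed

lemma double_le_of_square_le:
  assumes "real (2 * r\<^sup>2) \<le> (real N)\<^sup>2 / 2"
  shows "2 * r \<le> N"
proof -
  have "(real (2 * r))\<^sup>2 \<le> (real N)\<^sup>2"
    using assms by (simp add: power_mult_distrib)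
  then show ?thesis
    using power2_le_imp_le[of "real (2 * r)" "real N"] by linarith
qed

lemma traffic_mono: "k \<le> l \<Longrightarrow> traffic N k \<subseteq> traffic N l"
  by (auto simp: traffic_def)

theorem theorem1:
  fixes N k :: nat
  assumes "N \<ge> 2" and "k \<ge> 1" and "real k \<le> (real N)\<^sup>2 / 2"
  shows
    "(is_square (2 * k) \<longrightarrow>
       (\<exists>r::nat. real r = sqrt (real k / 2) \<and>
          (\<exists>d\<in>traffic N k. \<forall>g\<in>sym_routings N. max_load N g d \<ge> sqrt (2 * real k) / 4) \<and>
          (even N \<longrightarrow>
             split_diamond N r \<in> traffic N k \<and>
             (\<forall>g\<in>sym_routings N.
                max_load N g (split_diamond N r) \<ge> sqrt (2 * real k) / 4)))) \<and>
     (\<not> is_square (2 * k) \<longrightarrow>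
       (let k' = Max {m::nat. m \<le> k \<and> is_square (2 * m)} in
          \<exists>d\<in>traffic N k. \<forall>g\<in>sym_routings N. max_load N g d \<ge> sqrt (2 * real k') / 4))"
proof -
  \<comment> \<open>Used with \<open>k' = k\<close> for (a) and with the largest admissible
    \<open>k'\<close> for (b), where \<open>traffic_mono\<close> passes from \<open>k'\<close> to
    \<open>k\<close>.\<close>
  have diamond: "2 * r \<le> N" "diamond_traffic N r \<in> traffic N k"
    "\<forall>g\<in>sym_routings N. max_load N g (diamond_traffic N r) \<ge> sqrt (2 * real k') / 4"
    if k': "k' = 2 * r\<^sup>2" "k' \<le> k" for k' r
  proof -
    have "real (2 * r\<^sup>2) \<le> (real N)\<^sup>2 / 2"
      using k' assms(3) by linarith
    then show r: "2 * r \<le> N"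
      by (rule double_le_of_square_le)
    show "diamond_traffic N r \<in> traffic N k"
      using diamond_traffic_in_traffic[OF assms(1) r] traffic_mono k' by blast
    show "\<forall>g\<in>sym_routings N. max_load N g (diamond_traffic N r) \<ge> sqrt (2 * real k') / 4"
      unfolding k'(1) sqrt_double using max_load_diamond_traffic[OF assms(1) r] by blast
  qed
  show ?thesis
  proof (intro conjI impI)
    assume "is_square (2 * k)"
    then obtain r where r: "k = 2 * r\<^sup>2"
      unfolding is_square_double_iff by blast
    note d = diamond[OF r order.refl]
    have "real r = sqrt (real k / 2)"
      by (simp add: r)
    moreover have "diamond_traffic N r = split_diamond N r" if "even N"
      using that assms(1) d(1) by (intro diamond_traffic_eq_split_diamond) auto
    ultimately show "\<exists>r::nat. real r = sqrt (real k / 2) \<and>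
          (\<exists>d\<in>traffic N k. \<forall>g\<in>sym_routings N. max_load N g d \<ge> sqrt (2 * real k) / 4) \<and>
          (even N \<longrightarrow>
             split_diamond N r \<in> traffic N k \<and>
             (\<forall>g\<in>sym_routings N.
                max_load N g (split_diamond N r) \<ge> sqrt (2 * real k) / 4))"
      using d(2,3) by (intro exI[of _ r]) auto
  next
    define k' where "k' = Max {m::nat. m \<le> k \<and> is_square (2 * m)}"
    \<comment> \<open>Since 0 qualifies, the set is nonempty and \<open>Max\<close> is attained. For
      \<open>k = 1\<close> it is the only element, and the bound degenerates to 0.\<close>
    have "0 \<in> {m::nat. m \<le> k \<and> is_square (2 * m)}"
      by (simp add: is_square_double_iff)
    then have "k' \<in> {m::nat. m \<le> k \<and> is_square (2 * m)}"
      unfolding k'_def by (intro Max_in) auto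
    then obtain r where r: "k' = 2 * r\<^sup>2" "k' \<le> k"
      unfolding is_square_double_iff by blast
    show "let k' = Max {m::nat. m \<le> k \<and> is_square (2 * m)} in
          \<exists>d\<in>traffic N k. \<forall>g\<in>sym_routings N. max_load N g d \<ge> sqrt (2 * real k') / 4"
      unfolding Let_def k'_def[symmetric] using diamond[OF r] by blast
  qed
qed

end
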